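(* Let $p\in(1,\infty]$, let $\Omega\subset\mathbb{R}^d$ be a bounded $C^2$-domain, and let $g\in C(\partial\Omega)$. Consider the Dirichlet problem $-\Delta_p w=0$ in $\Omega$, $w=g$ on $\partial\Omega$. The following are equivalent: (a) $u$ is a viscosity $p$-subsolution (resp. $p$-supersolution) of the Dirichlet problem; (b) $u$ is a generalized viscosity $p$-subsolution (resp. $p$-supersolution) of the Dirichlet problem.
   Context: For $p\in(1,\infty)$, $\Delta_p\phi=\mathrm{div}(|\nabla\phi|^{p-2}\nabla\phi)$, and $\Delta_\infty\phi=\langle D^2\phi\,\nabla\phi,\nabla\phi\rangle$. $\mathrm{USC}(\overline\Omega)$, $\mathrm{LSC}(\overline\Omega)$ denote upper and lower semicontinuous functions. **Viscosity.** $u\in \mathrm{USC}(\overline\Omega)$ is a viscosity $p$-subsolution if whenever $x_0\in\overline\Omega$ and $\phi\in C^2(\overline\Omega)$ satisfy $\phi(x_0)=u(x_0)$, $\phi(x)>u(x)$ for $x\ne x_0$, and $\nabla\phi(x_0)\neq0$, then - $-\Delta_p\phi(x_0)\le0$ if $x_0\in\Omega$, and - $u(x_0)-g(x_0)\le0$ if $x_0\in\partial\Omega$. $u\in \mathrm{LSC}(\overline\Omega)$ is a viscosity $p$-supersolution if whenever $x_0\in\overline\Omega$ and $\phi\in C^2(\overline\Omega)$ satisfy $\phi(x_0)=u(x_0)$, $\phi(x)<u(x)$ for $x\neq x_0$, and $\nabla\phi(x_0)\ne0$, then - $-\Delta_p\phi(x_0)\ge0$ if $x_0\in\Omega$, and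 - $u(x_0)-g(x_0)\ge0$ if $x_0\in\partial\Omega$. **Generalized viscosity.** A generalized viscosity $p$-subsolution (resp. $p$-supersolution) is defined in the same way (same function class, same test functions, same condition at $x_0\in\Omega$), except that the condition at $x_0\in\partial\Omega$ is replaced by $\min\{-\Delta_p\phi(x_0),\,u(x_0)-g(x_0)\}\le0$ (resp. $\max\{-\Delta_p\phi(x_0),\,u(x_0)-g(x_0)\}\ge0$). *)

theory Defs
  imports "HOL-Analysis.Analysis"
begin

section \<open>Differential operators\<close>

definition grad :: "('a::euclidean_space \<Rightarrow> real) \<Rightarrow> 'a \<Rightarrow> 'a" where
  "grad \<phi> x = (THE D. GDERIV \<phi> x :> D)"

text \<open>The Hessian is kept as the linear map \<open>h \<mapsto> D\<^sup>2\<phi>(x) h\<close>.\<close>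

definition hess :: "('a::euclidean_space \<Rightarrow> real) \<Rightarrow> 'a \<Rightarrow> 'a \<Rightarrow> 'a" where
  "hess \<phi> x = frechet_derivative (grad \<phi>) (at x)"

definition divergence :: "('a::euclidean_space \<Rightarrow> 'a) \<Rightarrow> 'a \<Rightarrow> real" where
  "divergence F x = (\<Sum>i\<in>Basis. frechet_derivative F (at x) i \<bullet> i)"

text \<open>
  For finite \<open>p\<close> the value is meaningful only where the gradient does not vanish
  (\<open>0 powr a = 0\<close> for every \<open>a\<close>); the definitions of solutions below only use such points.
\<close>

definition p_laplacian :: "ereal \<Rightarrow> ('a::euclidean_space \<Rightarrow> real) \<Rightarrow> 'a \<Rightarrow> real" where
  "p_laplacian p \<phi> x =
     (if p = \<infinity> then hess \<phi> x (grad \<phi> x) \<bullet> grad \<phi> x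
      else divergence (\<lambda>y. norm (grad \<phi> y) powr (real_of_ereal p - 2) *\<^sub>R grad \<phi> y) x)"


section \<open>Function classes\<close>

definition usc_on :: "'a::topological_space set \<Rightarrow> ('a \<Rightarrow> real) \<Rightarrow> bool" where
  "usc_on S u \<longleftrightarrow> (\<forall>x\<in>S. \<forall>a>u x. \<forall>\<^sub>F y in at x within S. u y < a)"

definition lsc_on :: "'a::topological_space set \<Rightarrow> ('a \<Rightarrow> real) \<Rightarrow> bool" where
  "lsc_on S u \<longleftrightarrow> (\<forall>x\<in>S. \<forall>a<u x. \<forall>\<^sub>F y in at x within S. a < u y)"

text \<open>\<open>C\<^sup>2(U)\<close>, for \<open>U\<close> open.\<close>

definition C2_on :: "'a::euclidean_space set \<Rightarrow> ('a \<Rightarrow> real) \<Rightarrow> bool" where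
  "C2_on U \<phi> \<longleftrightarrow>
     (\<forall>x\<in>U. \<phi> differentiable (at x)) \<and>
     (\<forall>x\<in>U. grad \<phi> differentiable (at x)) \<and>
     (\<forall>i\<in>Basis. continuous_on U (\<lambda>x. hess \<phi> x i))"

definition extends_to_closure ::
    "'a::topological_space set \<Rightarrow> ('a \<Rightarrow> 'b::topological_space) \<Rightarrow> bool" where
  "extends_to_closure \<Omega> f \<longleftrightarrow> (\<exists>F. continuous_on (closure \<Omega>) F \<and> (\<forall>x\<in>\<Omega>. F x = f x))"

text \<open>
  \<open>C\<^sup>2\<close> up to the boundary: all derivatives of order at most two extend continuously from
  \<open>\<Omega>\<close> to its closure. The values of \<open>\<phi>\<close> outside the closure are irrelevant.
\<close>

definition C2_closure :: "'a::euclidean_space set \<Rightarrow> ('a \<Rightarrow> real) \<Rightarrow> bool" where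
  "C2_closure \<Omega> \<phi> \<longleftrightarrow>
     C2_on \<Omega> \<phi> \<and>
     continuous_on (closure \<Omega>) \<phi> \<and>
     extends_to_closure \<Omega> (grad \<phi>) \<and>
     (\<forall>i\<in>Basis. extends_to_closure \<Omega> (\<lambda>x. hess \<phi> x i))"

text \<open>
  At a boundary point, a differential expression in a function that is \<open>C\<^sup>2\<close> up to the boundary
  denotes its continuous extension from \<open>\<Omega>\<close>. For \<open>p_laplacian\<close> the limit exists as soon as the
  extended gradient is nonzero at the point, since the operator is then a continuous function
  of the first and second derivatives nearby.
\<close>

definition upto_boundary ::
    "'a::euclidean_space set \<Rightarrow> ('a \<Rightarrow> 'b::t2_space) \<Rightarrow> 'a \<Rightarrow> 'b" where
  "upto_boundary \<Omega> f x = (if x \<in> \<Omega> then f x else Lim (at x within \<Omega>) f)"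


section \<open>Domains with twice continuously differentiable boundary\<close>

text \<open>
  Near each boundary point, after a rotation of the axes that makes \<open>\<nu>\<close> the last unit vector, the
  set is the region strictly above the graph of a \<open>C\<^sup>2\<close> function of the remaining coordinates.
  Here \<open>x - (x \<bullet> \<nu>) *\<^sub>R \<nu>\<close> is the projection of \<open>x\<close> to the hyperplane orthogonal to \<open>\<nu>\<close>, and
  \<open>\<gamma>\<close> is only evaluated there; a \<open>C\<^sup>2\<close> function on that hyperplane extends to the whole space by
  composition with the projection.
\<close>

definition C2_boundary :: "'a::euclidean_space set \<Rightarrow> bool" where
  "C2_boundary \<Omega> \<longleftrightarrow>
     (\<forall>x0\<in>frontier \<Omega>. \<exists>r>0. \<exists>\<nu> \<gamma>. norm \<nu> = 1 \<and> C2_on UNIV \<gamma> \<and>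
        \<Omega> \<inter> ball x0 r = {x \<in> ball x0 r. \<gamma> (x - (x \<bullet> \<nu>) *\<^sub>R \<nu>) < x \<bullet> \<nu>})"

definition C2_domain :: "'a::euclidean_space set \<Rightarrow> bool" where
  "C2_domain \<Omega> \<longleftrightarrow> open \<Omega> \<and> connected \<Omega> \<and> \<Omega> \<noteq> {} \<and> C2_boundary \<Omega>"


section \<open>Viscosity solutions of the Dirichlet problem\<close>

definition touches_from_above ::
    "'a set \<Rightarrow> ('a \<Rightarrow> real) \<Rightarrow> ('a \<Rightarrow> real) \<Rightarrow> 'a \<Rightarrow> bool" where
  "touches_from_above S \<phi> u x0 \<longleftrightarrow> \<phi> x0 = u x0 \<and> (\<forall>x\<in>S. x \<noteq> x0 \<longrightarrow> \<phi> x > u x)"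

definition touches_from_below ::
    "'a set \<Rightarrow> ('a \<Rightarrow> real) \<Rightarrow> ('a \<Rightarrow> real) \<Rightarrow> 'a \<Rightarrow> bool" where
  "touches_from_below S \<phi> u x0 \<longleftrightarrow> \<phi> x0 = u x0 \<and> (\<forall>x\<in>S. x \<noteq> x0 \<longrightarrow> \<phi> x < u x)"

definition viscosity_subsolution ::
    "ereal \<Rightarrow> 'a::euclidean_space set \<Rightarrow> ('a \<Rightarrow> real) \<Rightarrow> ('a \<Rightarrow> real) \<Rightarrow> bool" where
  "viscosity_subsolution p \<Omega> g u \<longleftrightarrow>
     usc_on (closure \<Omega>) u \<and>
     (\<forall>x0\<in>closure \<Omega>. \<forall>\<phi>.
        C2_closure \<Omega> \<phi> \<and> touches_from_above (closure \<Omega>) \<phi> u x0 \<and>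
        upto_boundary \<Omega> (grad \<phi>) x0 \<noteq> 0 \<longrightarrow>
          (x0 \<in> \<Omega> \<longrightarrow> - p_laplacian p \<phi> x0 \<le> 0) \<and>
          (x0 \<in> frontier \<Omega> \<longrightarrow> u x0 - g x0 \<le> 0))"

definition viscosity_supersolution ::
    "ereal \<Rightarrow> 'a::euclidean_space set \<Rightarrow> ('a \<Rightarrow> real) \<Rightarrow> ('a \<Rightarrow> real) \<Rightarrow> bool" where
  "viscosity_supersolution p \<Omega> g u \<longleftrightarrow>
     lsc_on (closure \<Omega>) u \<and>
     (\<forall>x0\<in>closure \<Omega>. \<forall>\<phi>.
        C2_closure \<Omega> \<phi> \<and> touches_from_below (closure \<Omega>) \<phi> u x0 \<and>
        upto_boundary \<Omega> (grad \<phi>) x0 \<noteq> 0 \<longrightarrow>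
          (x0 \<in> \<Omega> \<longrightarrow> - p_laplacian p \<phi> x0 \<ge> 0) \<and>
          (x0 \<in> frontier \<Omega> \<longrightarrow> u x0 - g x0 \<ge> 0))"

definition generalized_viscosity_subsolution ::
    "ereal \<Rightarrow> 'a::euclidean_space set \<Rightarrow> ('a \<Rightarrow> real) \<Rightarrow> ('a \<Rightarrow> real) \<Rightarrow> bool" where
  "generalized_viscosity_subsolution p \<Omega> g u \<longleftrightarrow>
     usc_on (closure \<Omega>) u \<and>
     (\<forall>x0\<in>closure \<Omega>. \<forall>\<phi>.
        C2_closure \<Omega> \<phi> \<and> touches_from_above (closure \<Omega>) \<phi> u x0 \<and>
        upto_boundary \<Omega> (grad \<phi>) x0 \<noteq> 0 \<longrightarrow>
          (x0 \<in> \<Omega> \<longrightarrow> - p_laplacian p \<phi> x0 \<le> 0) \<and>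
          (x0 \<in> frontier \<Omega> \<longrightarrow>
             min (- upto_boundary \<Omega> (p_laplacian p \<phi>) x0) (u x0 - g x0) \<le> 0))"

definition generalized_viscosity_supersolution ::
    "ereal \<Rightarrow> 'a::euclidean_space set \<Rightarrow> ('a \<Rightarrow> real) \<Rightarrow> ('a \<Rightarrow> real) \<Rightarrow> bool" where
  "generalized_viscosity_supersolution p \<Omega> g u \<longleftrightarrow>
     lsc_on (closure \<Omega>) u \<and>
     (\<forall>x0\<in>closure \<Omega>. \<forall>\<phi>.
        C2_closure \<Omega> \<phi> \<and> touches_from_below (closure \<Omega>) \<phi> u x0 \<and>
        upto_boundary \<Omega> (grad \<phi>) x0 \<noteq> 0 \<longrightarrow>
          (x0 \<in> \<Omega> \<longrightarrow> - p_laplacian p \<phi> x0 \<ge> 0) \<and>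
          (x0 \<in> frontier \<Omega> \<longrightarrow>
             max (- upto_boundary \<Omega> (p_laplacian p \<phi>) x0) (u x0 - g x0) \<ge> 0))"

end

theory Submission
  imports Defs
begin

text \<open>
  If \<open>u\<close> satisfies the boundary inequality itself, it satisfies the weaker one with \<open>min\<close> or \<open>max\<close>.
  The converse rests on the freedom in the choice of the test function. Suppose \<open>\<phi>\<close> touches a
  generalized subsolution \<open>u\<close> from above at a boundary point \<open>x0\<close>. Any larger \<open>C\<^sup>2\<close>
  function \<open>\<psi>\<close> with the same value at \<open>x0\<close> also touches \<open>u\<close>, and since the domain lies on one side
  of \<open>x0\<close>, the normal derivative of \<open>\<psi>\<close> there may be increased and its second normal derivative
  then chosen at will. If \<open>\<psi>\<close> is strongly concave in the normal direction, then
  \<open>-\<Delta>\<^sub>p \<psi>(x0) > 0\<close>, so the generalized condition for \<open>\<psi>\<close> leaves only \<open>u(x0) - g(x0) \<le> 0\<close>.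

  The enlargement is global. A \<open>C\<^sup>2\<close> boundary has an exterior paraboloid at \<open>x0\<close>: a quadratic
  polynomial \<open>s(x) = (x - x0) \<bullet> N + C |x - x0|\<^sup>2\<close> with \<open>N \<noteq> 0\<close> that is nonnegative on the whole
  closure of the domain (\<open>C2_boundary_exterior_paraboloid\<close>). With
  \<open>\<psi> = \<phi> + \<alpha> (1 - exp(- k s)) / k\<close>, as in the proof of Hopf's lemma, \<open>\<psi> \<ge> \<phi>\<close> on the closure, and
  at \<open>x0\<close>
    \<^item> the gradient changes by \<open>\<alpha> N\<close>, whatever \<open>k\<close> is; a suitable \<open>\<alpha>\<close> makes the new gradient \<open>q\<close>
      satisfy \<open>q \<bullet> N \<noteq> 0\<close>;
    \<^item> the Hessian changes by a fixed matrix minus \<open>\<alpha> k N \<otimes> N\<close>.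

  In nondivergence form the \<open>p\<close>-Laplacian is linear in the Hessian and continuous in all arguments
  where the gradient does not vanish (\<open>p_laplacian_eq_p_form\<close>, \<open>tendsto_p_form\<close>), and for \<open>p > 1\<close> it
  is strictly positive on \<open>N \<otimes> N\<close> once \<open>q \<bullet> N \<noteq> 0\<close> (\<open>p_form_rank_one_pos\<close>). Hence
  \<open>\<Delta>\<^sub>p \<psi>(x0) < 0\<close> for large \<open>k\<close> (\<open>boundary_barrier\<close>). Supersolutions are treated by the same construction with
  \<open>\<alpha>\<close> replaced by \<open>-\<alpha>\<close>; a sign \<open>\<sigma>\<close> covers both cases.
\<close>

section \<open>Gradients and Hessians\<close>

lemma grad_eqI:
  fixes f :: "'a::euclidean_space \<Rightarrow> real"
  assumes "GDERIV f x :> D"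
  shows "grad f x = D"
  unfolding grad_def
proof (rule the_equality)
  show "GDERIV f x :> D" by (fact assms)
next
  fix E assume "GDERIV f x :> E"
  then have "(\<lambda>v. v \<bullet> E) = (\<lambda>v. v \<bullet> D)"
    using assms has_derivative_unique unfolding gderiv_def by blast
  then show "E = D"
    by (metis vector_eq_ldot)
qed

lemma gderiv_grad:
  fixes f :: "'a::euclidean_space \<Rightarrow> real"
  assumes "f differentiable (at x)"
  shows "GDERIV f x :> grad f x"
proof -
  obtain f' where f': "(f has_derivative f') (at x)"
    using assms unfolding differentiable_def by blast
  have lin: "linear f'"
    using f' has_derivative_linear by blast
  have "f' = (\<lambda>v. v \<bullet> (\<Sum>i\<in>Basis. f' i *\<^sub>R i))"
  proof
    fix v
    have "f' v = f' (\<Sum>i\<in>Basis. (v \<bullet> i) *\<^sub>R i)"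
      by (simp add: euclidean_representation)
    also have "\<dots> = (\<Sum>i\<in>Basis. (v \<bullet> i) * f' i)"
      using lin by (simp add: linear_sum linear_cmul)
    finally show "f' v = v \<bullet> (\<Sum>i\<in>Basis. f' i *\<^sub>R i)"
      by (simp add: inner_sum_right mult.commute)
  qed
  with f' have D: "GDERIV f x :> (\<Sum>i\<in>Basis. f' i *\<^sub>R i)"
    unfolding gderiv_def by metis
  then show ?thesis
    using grad_eqI[OF D] by simp
qed

lemma has_derivative_hess:
  assumes "grad f differentiable (at x)"
  shows "(grad f has_derivative hess f x) (at x)"
  using assms unfolding hess_def by (simp add: frechet_derivative_works)

lemma hess_eqI:
  assumes "(grad f has_derivative H) (at x)"
  shows "hess f x = H"
  using assms unfolding hess_def by (metis frechet_derivative_at)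

lemma
  fixes \<phi> h :: "'a::euclidean_space \<Rightarrow> real"
  assumes "open \<Omega>" "C2_on \<Omega> \<phi>" "x \<in> \<Omega>"
    and h: "\<And>x. GDERIV h x :> gh x" "\<And>x. (gh has_derivative Hh x) (at x)"
  shows grad_add_smooth: "grad (\<lambda>y. \<phi> y + h y) x = grad \<phi> x + gh x"
    and has_derivative_grad_add_smooth:
      "(grad (\<lambda>y. \<phi> y + h y) has_derivative (\<lambda>v. hess \<phi> x v + Hh x v)) (at x)"
proof -
  have g: "grad (\<lambda>y. \<phi> y + h y) y = grad \<phi> y + gh y" if "y \<in> \<Omega>" for y
    using that assms(2) h(1)
    by (intro grad_eqI GDERIV_add gderiv_grad) (auto simp: C2_on_def)
  then show "grad (\<lambda>y. \<phi> y + h y) x = grad \<phi> x + gh x"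
    using assms by blast
  have "((\<lambda>y. grad \<phi> y + gh y) has_derivative (\<lambda>v. hess \<phi> x v + Hh x v)) (at x)"
    using assms(2,3) h(2)
    by (intro has_derivative_add has_derivative_hess) (auto simp: C2_on_def)
  then show "(grad (\<lambda>y. \<phi> y + h y) has_derivative (\<lambda>v. hess \<phi> x v + Hh x v)) (at x)"
    by (rule has_derivative_transform_within_open[OF _ assms(1,3)]) (simp add: g)
qed

lemma extends_to_closure_add:
  fixes f F :: "'a::topological_space \<Rightarrow> 'b::real_normed_vector"
  assumes "extends_to_closure \<Omega> f" "continuous_on UNIV F" "\<And>x. x \<in> \<Omega> \<Longrightarrow> f' x = f x + F x"
  shows "extends_to_closure \<Omega> f'"
proof -
  obtain G where G: "continuous_on (closure \<Omega>) G" "\<And>x. x \<in> \<Omega> \<Longrightarrow> G x = f x"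
    using assms(1) unfolding extends_to_closure_def by blast
  have "continuous_on (closure \<Omega>) F"
    using assms(2) continuous_on_subset by blast
  with G have "continuous_on (closure \<Omega>) (\<lambda>x. G x + F x)"
    by (intro continuous_on_add)
  with G assms(3) show ?thesis
    unfolding extends_to_closure_def by (metis (no_types, lifting))
qed

lemma C2_closure_add_smooth:
  fixes \<phi> h :: "'a::euclidean_space \<Rightarrow> real"
  assumes "open \<Omega>" "C2_closure \<Omega> \<phi>"
    and h: "\<And>x. GDERIV h x :> gh x" "\<And>x. (gh has_derivative Hh x) (at x)"
      "\<And>i. i \<in> Basis \<Longrightarrow> continuous_on UNIV (\<lambda>x. Hh x i)"
  shows "C2_closure \<Omega> (\<lambda>x. \<phi> x + h x)"
proof -
  have C2: "C2_on \<Omega> \<phi>" and cont: "continuous_on (closure \<Omega>) \<phi>"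
    and ext: "extends_to_closure \<Omega> (grad \<phi>)"
      "\<And>i. i \<in> Basis \<Longrightarrow> extends_to_closure \<Omega> (\<lambda>x. hess \<phi> x i)"
    using assms(2) unfolding C2_closure_def by auto
  note g = grad_add_smooth[OF assms(1) C2 _ h(1,2)]
  note dg = has_derivative_grad_add_smooth[OF assms(1) C2 _ h(1,2)]
  note H = hess_eqI[OF dg]
  have dh: "(h has_derivative (\<lambda>v. v \<bullet> gh x)) (at x)" for x
    using h(1) unfolding gderiv_def by (simp add: inner_commute)
  have conth: "continuous_on UNIV h"
    by (intro continuous_at_imp_continuous_on ballI has_derivative_continuous[OF dh])
  have contgh: "continuous_on UNIV gh"
    by (intro continuous_at_imp_continuous_on ballI has_derivative_continuous[OF h(2)])
  have "C2_on \<Omega> (\<lambda>x. \<phi> x + h x)"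
    unfolding C2_on_def
  proof (intro conjI ballI)
    fix x assume "x \<in> \<Omega>"
    then show "(\<lambda>x. \<phi> x + h x) differentiable at x"
      using C2 dh unfolding C2_on_def
      by (intro differentiable_add) (auto intro: differentiableI)
    show "grad (\<lambda>x. \<phi> x + h x) differentiable at x"
      using dg[OF \<open>x \<in> \<Omega>\<close>] differentiable_def by blast
  next
    fix i :: 'a assume i: "i \<in> Basis"
    have "continuous_on \<Omega> (\<lambda>x. hess \<phi> x i + Hh x i)"
      using C2 i h(3)[OF i] unfolding C2_on_def
      by (intro continuous_on_add) (auto intro: continuous_on_subset)
    then show "continuous_on \<Omega> (\<lambda>x. hess (\<lambda>x. \<phi> x + h x) x i)"
      by (rule continuous_on_eq) (simp add: H)
  qed
  moreover have "continuous_on (closure \<Omega>) (\<lambda>x. \<phi> x + h x)"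
    using cont conth by (intro continuous_on_add) (auto intro: continuous_on_subset)
  moreover have "extends_to_closure \<Omega> (grad (\<lambda>x. \<phi> x + h x))"
    using extends_to_closure_add[OF ext(1) contgh] g by blast
  moreover have "extends_to_closure \<Omega> (\<lambda>x. hess (\<lambda>x. \<phi> x + h x) x i)" if "i \<in> Basis" for i
    using extends_to_closure_add[OF ext(2)[OF that] h(3)[OF that]] H by simp
  ultimately show ?thesis
    unfolding C2_closure_def by blast
qed


section \<open>The \<open>p\<close>-Laplacian in nondivergence form\<close>

text \<open>
  The operator as a function of a gradient \<open>q\<close> and a Hessian \<open>H\<close>:
  \<open>|q|\<^bsup>p-2\<^esup> (tr H + (p - 2) \<langle>H q, q\<rangle> / |q|\<^sup>2)\<close>, and \<open>\<langle>H q, q\<rangle>\<close> for \<open>p = \<infinity>\<close>. It is written through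
  the values of \<open>H\<close> on the basis alone, because the Hessian columns are what extends continuously
  to the boundary.
\<close>

definition p_form :: "ereal \<Rightarrow> 'a::euclidean_space \<Rightarrow> ('a \<Rightarrow> 'a) \<Rightarrow> real" where
  "p_form p q H =
     (if p = \<infinity> then \<Sum>i\<in>Basis. (q \<bullet> i) * (H i \<bullet> q)
      else norm q powr (real_of_ereal p - 2) *
        ((\<Sum>i\<in>Basis. H i \<bullet> i) +
         (real_of_ereal p - 2) / (norm q)\<^sup>2 * (\<Sum>i\<in>Basis. (q \<bullet> i) * (H i \<bullet> q))))"

lemma linear_quadratic_form_Basis:
  fixes H :: "'a::euclidean_space \<Rightarrow> 'a"
  assumes "linear H"
  shows "H q \<bullet> q = (\<Sum>i\<in>Basis. (q \<bullet> i) * (H i \<bullet> q))"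
proof -
  have "H q = H (\<Sum>i\<in>Basis. (q \<bullet> i) *\<^sub>R i)"
    by (simp add: euclidean_representation)
  also have "\<dots> = (\<Sum>i\<in>Basis. (q \<bullet> i) *\<^sub>R H i)"
    using assms by (simp add: linear_sum linear_cmul)
  finally show ?thesis
    by (simp add: inner_sum_left)
qed

lemma has_derivative_norm_powr_scaleR:
  fixes F :: "'a::euclidean_space \<Rightarrow> 'a"
  assumes F: "(F has_derivative H) (at x)" and nz: "F x \<noteq> 0"
  shows "((\<lambda>y. norm (F y) powr a *\<^sub>R F y) has_derivative
           (\<lambda>v. norm (F x) powr a *\<^sub>R (H v + (a / (norm (F x))\<^sup>2 * (H v \<bullet> F x)) *\<^sub>R F x))) (at x)"
proof -
  have n: "((\<lambda>y. norm (F y)) has_derivative (\<lambda>v. H v \<bullet> sgn (F x))) (at x)"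
    using has_derivative_compose[OF F has_derivative_norm[OF nz]] by (simp add: inner_commute)
  have pos: "norm (F x) > 0" using nz by simp
  have "((\<lambda>y. norm (F y) powr a) has_derivative
      (\<lambda>v. norm (F x) powr a * (a / (norm (F x))\<^sup>2 * (H v \<bullet> F x)))) (at x)"
    by (rule has_derivative_eq_rhs[OF has_derivative_powr[OF n has_derivative_const pos]])
      (auto simp: sgn_div_norm power2_eq_square divide_simps)
  from has_derivative_scaleR[OF this F] show ?thesis
    by (rule has_derivative_eq_rhs) (auto simp: algebra_simps)
qed

lemma p_laplacian_eq_p_form:
  fixes \<phi> :: "'a::euclidean_space \<Rightarrow> real"
  assumes H: "(grad \<phi> has_derivative H) (at x)" and nz: "grad \<phi> x \<noteq> 0"
  shows "p_laplacian p \<phi> x = p_form p (grad \<phi> x) H"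
proof (cases "p = \<infinity>")
  case True
  have "linear H" using H has_derivative_linear by blast
  then show ?thesis
    using True hess_eqI[OF H] linear_quadratic_form_Basis[of H "grad \<phi> x"]
    by (simp add: p_laplacian_def p_form_def)
next
  case False
  let ?q = "grad \<phi> x" and ?a = "real_of_ereal p - 2"
  have "p_laplacian p \<phi> x =
      (\<Sum>i\<in>Basis. (norm ?q powr ?a *\<^sub>R (H i + (?a / (norm ?q)\<^sup>2 * (H i \<bullet> ?q)) *\<^sub>R ?q)) \<bullet> i)"
    using False frechet_derivative_at[OF has_derivative_norm_powr_scaleR[OF H nz], symmetric]
    by (simp add: p_laplacian_def divergence_def)
  also have "\<dots> = p_form p ?q H"
    using False
    by (simp add: p_form_def inner_add_left sum.distrib sum_distrib_left sum_distrib_right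
        sum_divide_distrib algebra_simps)
  finally show ?thesis .
qed

lemma tendsto_p_form:
  fixes q :: "'b \<Rightarrow> 'a::euclidean_space"
  assumes "(q \<longlongrightarrow> q0) F" "\<And>i. i \<in> Basis \<Longrightarrow> ((\<lambda>x. H x i) \<longlongrightarrow> H0 i) F" "q0 \<noteq> 0"
  shows "((\<lambda>x. p_form p (q x) (H x)) \<longlongrightarrow> p_form p q0 H0) F"
  unfolding p_form_def using assms by (auto intro!: tendsto_intros)

lemma sum_Basis_inner_mult:
  fixes x y :: "'a::euclidean_space"
  shows "(\<Sum>i\<in>Basis. (x \<bullet> i) * (i \<bullet> y)) = x \<bullet> y"
  by (simp add: euclidean_inner[of x y] inner_commute)

lemma p_form_affine:
  "p_form p q (\<lambda>i. A i + t *\<^sub>R B i) = p_form p q A + t * p_form p q B"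
proof -
  have "(\<Sum>i\<in>Basis. (q \<bullet> i) * ((A i + t *\<^sub>R B i) \<bullet> q)) =
      (\<Sum>i\<in>Basis. (q \<bullet> i) * (A i \<bullet> q)) + t * (\<Sum>i\<in>Basis. (q \<bullet> i) * (B i \<bullet> q))"
    by (simp add: inner_add_left sum.distrib sum_distrib_left algebra_simps)
  moreover have "(\<Sum>i\<in>Basis. (A i + t *\<^sub>R B i) \<bullet> i) = (\<Sum>i\<in>Basis. A i \<bullet> i) + t * (\<Sum>i\<in>Basis. B i \<bullet> i)"
    by (simp add: inner_add_left sum.distrib sum_distrib_left algebra_simps)
  ultimately show ?thesis
    unfolding p_form_def by (simp add: algebra_simps add_divide_distrib)
qed

text \<open>
  Apart from the power of \<open>|q|\<close>, the value for finite \<open>p\<close> is \<open>|N|\<^sup>2 + (p - 2) c\<close>, where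
  \<open>c = (q \<bullet> N)\<^sup>2 / |q|\<^sup>2\<close> lies in \<open>{0<..|N|\<^sup>2}\<close> by the Cauchy--Schwarz inequality; so it is at least
  \<open>(p - 1) c\<close>. This is where ellipticity, and with it \<open>p > 1\<close>, enters.
\<close>

lemma p_form_rank_one_pos:
  fixes q N :: "'a::euclidean_space"
  assumes p: "1 < p" and qN: "q \<bullet> N \<noteq> 0"
  shows "0 < p_form p q (\<lambda>i. (i \<bullet> N) *\<^sub>R N)"
proof -
  have quad: "(\<Sum>i\<in>Basis. (q \<bullet> i) * (((i \<bullet> N) *\<^sub>R N) \<bullet> q)) = (q \<bullet> N)\<^sup>2"
  proof -
    have "(\<Sum>i\<in>Basis. (q \<bullet> i) * (((i \<bullet> N) *\<^sub>R N) \<bullet> q)) = (\<Sum>i\<in>Basis. (q \<bullet> i) * (i \<bullet> N)) * (N \<bullet> q)"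
      by (simp add: sum_distrib_right mult.assoc)
    also have "\<dots> = (q \<bullet> N)\<^sup>2"
      unfolding sum_Basis_inner_mult by (simp add: power2_eq_square inner_commute)
    finally show ?thesis .
  qed
  have tr: "(\<Sum>i\<in>Basis. ((i \<bullet> N) *\<^sub>R N) \<bullet> i) = (norm N)\<^sup>2"
    using sum_Basis_inner_mult[of N N] by (simp add: inner_commute power2_norm_eq_inner)
  show ?thesis
  proof (cases "p = \<infinity>")
    case True
    with quad qN show ?thesis by (simp add: p_form_def)
  next
    case False
    define a where "a = real_of_ereal p"
    have a: "a > 1" using p False unfolding a_def by (cases p) auto
    have q: "norm q > 0" using qN by auto
    define c where "c = (q \<bullet> N)\<^sup>2 / (norm q)\<^sup>2"
    have c0: "c > 0" using qN q unfolding c_def by simp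
    have "(q \<bullet> N)\<^sup>2 \<le> (norm q)\<^sup>2 * (norm N)\<^sup>2"
      using Cauchy_Schwarz_ineq[of q N] by (simp add: power2_norm_eq_inner)
    then have cN: "c \<le> (norm N)\<^sup>2"
      using q unfolding c_def by (simp add: divide_simps mult.commute)
    have "(norm N)\<^sup>2 + (a - 2) * c = ((norm N)\<^sup>2 - c) + (a - 1) * c"
      by (simp add: algebra_simps)
    also have "\<dots> > 0" using cN c0 a by (simp add: add_nonneg_pos)
    finally have "0 < (norm N)\<^sup>2 + (a - 2) * c" .
    moreover have "p_form p q (\<lambda>i. (i \<bullet> N) *\<^sub>R N) = norm q powr (a - 2) * ((norm N)\<^sup>2 + (a - 2) * c)"
      using False quad tr by (simp add: p_form_def a_def c_def)
    ultimately show ?thesis using q by simp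
  qed
qed


section \<open>Exterior paraboloids\<close>

text \<open>
  Differentiability of the gradient at the single point \<open>z\<close> makes \<open>|grad f y - grad f z|\<close> at most
  a multiple of \<open>|y - z|\<close>; the mean value theorem on the ball through \<open>y\<close> does the rest.
\<close>

lemma quadratic_Taylor_bound:
  fixes f :: "'a::euclidean_space \<Rightarrow> real"
  assumes f: "\<And>x. f differentiable (at x)" and g: "grad f differentiable (at z)"
  obtains C \<delta> where "C > 0" "\<delta> > 0"
    "\<And>y. norm (y - z) < \<delta> \<Longrightarrow> \<bar>f y - f z - (y - z) \<bullet> grad f z\<bar> \<le> C * (norm (y - z))\<^sup>2"
proof -
  note d = has_derivative_hess[OF g]
  have bl: "bounded_linear (hess f z)" using d has_derivative_bounded_linear by blast
  then obtain K where K: "K > 0" "\<And>v. norm (hess f z v) \<le> norm v * K"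
    using bounded_linear.pos_bounded by blast
  obtain \<delta> where \<delta>: "\<delta> > 0" "\<And>y. norm (y - z) < \<delta> \<Longrightarrow>
      norm (grad f y - grad f z - hess f z (y - z)) \<le> 1 * norm (y - z)"
    using d unfolding has_derivative_at_alt by (metis zero_less_one)
  have lip: "norm (grad f y - grad f z) \<le> (K + 1) * norm (y - z)" if "norm (y - z) < \<delta>" for y
    using \<delta>(2)[OF that] K(2)[of "y - z"]
      norm_triangle_ineq[of "grad f y - grad f z - hess f z (y - z)" "hess f z (y - z)"]
    by (simp add: algebra_simps)
  show thesis
  proof (rule that[of "K + 1" \<delta>])
    fix y assume y: "norm (y - z) < \<delta>"
    have "norm (f y - f z - (y - z) \<bullet> grad f z) \<le> norm (y - z) * ((K + 1) * norm (y - z))"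
    proof (rule differentiable_bound_linearization[where S = "cball z (norm (y - z))"
          and f' = "\<lambda>x v. v \<bullet> grad f x" and ?x0.0 = z])
      fix t :: real assume "t \<in> {0..1}"
      then show "z + t *\<^sub>R (y - z) \<in> cball z (norm (y - z))"
        by (simp add: dist_norm mult_left_le_one_le)
    next
      fix x assume "x \<in> cball z (norm (y - z))"
      show "(f has_derivative (\<lambda>v. v \<bullet> grad f x)) (at x within cball z (norm (y - z)))"
        using gderiv_grad[OF f] unfolding gderiv_def
        by (rule has_derivative_at_withinI)
    next
      fix x assume "x \<in> cball z (norm (y - z))"
      then have le: "norm (x - z) \<le> norm (y - z)" by (simp add: dist_norm norm_minus_commute)
      show "onorm ((\<lambda>v. v \<bullet> grad f x) - (\<lambda>v. v \<bullet> grad f z)) \<le> (K + 1) * norm (y - z)"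
      proof (rule onorm_bound)
        show "0 \<le> (K + 1) * norm (y - z)" using K(1) by simp
        fix v
        have "norm (((\<lambda>v. v \<bullet> grad f x) - (\<lambda>v. v \<bullet> grad f z)) v) = \<bar>v \<bullet> (grad f x - grad f z)\<bar>"
          by (simp add: inner_diff_right)
        also have "\<dots> \<le> norm v * norm (grad f x - grad f z)"
          by (rule Cauchy_Schwarz_ineq2)
        also have "\<dots> \<le> norm v * ((K + 1) * norm (y - z))"
        proof (rule mult_left_mono)
          have "norm (grad f x - grad f z) \<le> (K + 1) * norm (x - z)"
            using le y by (intro lip) simp
          also have "\<dots> \<le> (K + 1) * norm (y - z)"
            using le K(1) by (intro mult_left_mono) auto
          finally show "norm (grad f x - grad f z) \<le> (K + 1) * norm (y - z)" .
        qed simp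
        finally show "norm (((\<lambda>v. v \<bullet> grad f x) - (\<lambda>v. v \<bullet> grad f z)) v)
            \<le> (K + 1) * norm (y - z) * norm v" by (simp add: mult.commute)
      qed
    qed simp
    then show "\<bar>f y - f z - (y - z) \<bullet> grad f z\<bar> \<le> (K + 1) * (norm (y - z))\<^sup>2"
      by (simp add: power2_eq_square algebra_simps)
  qed (use K(1) \<delta>(1) in auto)
qed

text \<open>
  Near \<open>x0\<close> the domain is \<open>{f > 0}\<close> with \<open>f(x) = x \<bullet> \<nu> - \<gamma>(P x)\<close>, where \<open>P\<close> is the projection along
  \<open>\<nu>\<close>. Taylor expansion bounds \<open>f\<close> from above by the polynomial whose \<open>N\<close> is the gradient of \<open>f\<close>
  at \<open>x0\<close>, which does not vanish since its component along \<open>\<nu>\<close> is \<open>1\<close>. Away from \<open>x0\<close> the quadratic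
  term dominates the linear one if \<open>C\<close> is large, so the local inequality becomes global.
\<close>

lemma C2_boundary_exterior_paraboloid:
  fixes \<Omega> :: "'a::euclidean_space set"
  assumes "open \<Omega>" "C2_boundary \<Omega>" and x0: "x0 \<in> frontier \<Omega>"
  obtains N C where "N \<noteq> 0"
    "\<And>x. x \<in> closure \<Omega> \<Longrightarrow> 0 \<le> (x - x0) \<bullet> N + C * (norm (x - x0))\<^sup>2"
proof -
  obtain r \<nu> \<gamma> where r: "r > 0" and \<nu>: "norm \<nu> = 1" and \<gamma>: "C2_on UNIV \<gamma>"
    and graph: "\<Omega> \<inter> ball x0 r = {x \<in> ball x0 r. \<gamma> (x - (x \<bullet> \<nu>) *\<^sub>R \<nu>) < x \<bullet> \<nu>}"
    using assms(2) x0 unfolding C2_boundary_def by blast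
  define P where "P x = x - (x \<bullet> \<nu>) *\<^sub>R \<nu>" for x
  define f where "f x = x \<bullet> \<nu> - \<gamma> (P x)" for x
  have \<nu>\<nu>: "\<nu> \<bullet> \<nu> = 1" using \<nu> by (simp add: norm_eq_1)
  have f_pos: "x \<in> \<Omega> \<longleftrightarrow> f x > 0" if "x \<in> ball x0 r" for x
    using graph that unfolding f_def P_def by (auto simp: set_eq_iff)
  have \<gamma>d: "\<gamma> differentiable at x" "grad \<gamma> differentiable at x" for x
    using \<gamma> unfolding C2_on_def by auto
  have cont\<gamma>: "continuous_on UNIV \<gamma>"
    using \<gamma>d(1) differentiable_imp_continuous_within continuous_at_imp_continuous_on by blast
  have contf: "continuous_on UNIV f"
    unfolding f_def P_def
    by (intro continuous_intros continuous_on_compose2[OF cont\<gamma>]) auto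
  have f_nonneg: "f x \<ge> 0" if "x \<in> closure \<Omega>" "x \<in> ball x0 r" for x
  proof -
    have "x \<in> closure (\<Omega> \<inter> ball x0 r)"
      using that open_Int_closure_subset[of "ball x0 r" \<Omega>] by (auto simp: Int_commute)
    moreover have "closure (\<Omega> \<inter> ball x0 r) \<subseteq> {x. 0 \<le> f x}"
    proof (rule closure_minimal)
      show "\<Omega> \<inter> ball x0 r \<subseteq> {x. 0 \<le> f x}" using f_pos by (auto simp: less_imp_le)
      show "closed {x. 0 \<le> f x}"
        using contf by (intro closed_Collect_le) auto
    qed
    ultimately show ?thesis by blast
  qed
  have "x0 \<in> closure \<Omega>" "x0 \<notin> \<Omega>"
    using x0 assms(1) by (auto simp: frontier_def interior_open)
  then have f0: "f x0 = 0"
    using f_pos[of x0] f_nonneg[of x0] r by auto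
  obtain K \<delta> where K: "K > 0" and \<delta>: "\<delta> > 0" and Taylor: "\<And>y. norm (y - P x0) < \<delta> \<Longrightarrow>
      \<bar>\<gamma> y - \<gamma> (P x0) - (y - P x0) \<bullet> grad \<gamma> (P x0)\<bar> \<le> K * (norm (y - P x0))\<^sup>2"
    using quadratic_Taylor_bound[OF \<gamma>d(1) \<gamma>d(2)] by metis
  define N where "N = \<nu> - P (grad \<gamma> (P x0))"
  have "N \<bullet> \<nu> = 1"
    unfolding N_def P_def using \<nu>\<nu> by (simp add: inner_diff_left)
  then have "N \<noteq> 0" by auto
  have Pdiff: "P x - P y = P (x - y)" for x y
    unfolding P_def by (simp add: algebra_simps)
  have Psym: "P x \<bullet> y = x \<bullet> P y" for x y
    unfolding P_def by (simp add: inner_diff_left inner_diff_right inner_commute)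
  have Pnorm: "norm (P x) \<le> norm x" for x
  proof -
    have "(norm (P x))\<^sup>2 = (norm x)\<^sup>2 - (x \<bullet> \<nu>)\<^sup>2"
      unfolding P_def power2_norm_eq_inner
      using \<nu>\<nu> by (simp add: inner_diff_left inner_diff_right inner_commute power2_eq_square)
    then have "(norm (P x))\<^sup>2 \<le> (norm x)\<^sup>2"
      using zero_le_power2[of "x \<bullet> \<nu>"] by linarith
    then show ?thesis by (rule power2_le_imp_le) simp
  qed
  define \<rho> where "\<rho> = min r \<delta>"
  define C where "C = max K (norm N / \<rho>)"
  have \<rho>: "\<rho> > 0" using r \<delta> unfolding \<rho>_def by simp
  show thesis
  proof (rule that[OF \<open>N \<noteq> 0\<close>])
    fix x assume x: "x \<in> closure \<Omega>"
    show "0 \<le> (x - x0) \<bullet> N + C * (norm (x - x0))\<^sup>2"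
    proof (cases "norm (x - x0) < \<rho>")
      case True
      then have "x \<in> ball x0 r" and near: "norm (P x - P x0) < \<delta>"
        using Pnorm[of "x - x0"]
        by (auto simp: \<rho>_def dist_norm norm_minus_commute Pdiff)
      then have "0 \<le> f x - f x0" using f_nonneg[OF x] f0 by simp
      also have "\<dots> = (x - x0) \<bullet> \<nu> - (\<gamma> (P x) - \<gamma> (P x0))"
        by (simp add: f_def inner_diff_left)
      also have "\<dots> \<le> (x - x0) \<bullet> \<nu> - (P x - P x0) \<bullet> grad \<gamma> (P x0) + K * (norm (P x - P x0))\<^sup>2"
        using Taylor[OF near] by linarith
      also have "\<dots> = (x - x0) \<bullet> N + K * (norm (P (x - x0)))\<^sup>2"
        by (simp add: N_def Pdiff Psym inner_diff_right)
      also have "\<dots> \<le> (x - x0) \<bullet> N + C * (norm (x - x0))\<^sup>2"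
        using K Pnorm[of "x - x0"] unfolding C_def
        by (intro add_left_mono mult_mono power_mono) auto
      finally show ?thesis .
    next
      case False
      have "norm N * norm (x - x0) \<le> (norm N / \<rho>) * (norm (x - x0))\<^sup>2"
      proof -
        have "norm N * norm (x - x0) * \<rho> \<le> norm N * norm (x - x0) * norm (x - x0)"
          using False by (intro mult_left_mono) auto
        then show ?thesis using \<rho> by (simp add: field_simps power2_eq_square)
      qed
      also have "\<dots> \<le> C * (norm (x - x0))\<^sup>2"
        unfolding C_def by (intro mult_right_mono) auto
      finally show ?thesis
        using Cauchy_Schwarz_ineq2[of "x - x0" N] by (simp add: mult.commute)
    qed
  qed
qed


section \<open>Barriers at boundary points\<close>

text \<open>
  As a function of \<open>s \<ge> 0\<close> the barrier has the sign of \<open>m\<close> for every \<open>k > 0\<close>; its first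
  derivative at \<open>s = 0\<close> is \<open>m\<close>, independently of \<open>k\<close>, and its second derivative there is \<open>- m k\<close>.
\<close>

lemma exponential_barrier_derivatives:
  fixes N x0 :: "'a::euclidean_space" and m k C :: real
  assumes k: "k \<noteq> 0"
    and s: "s = (\<lambda>x. (x - x0) \<bullet> N + C * (norm (x - x0))\<^sup>2)"
    and S: "S = (\<lambda>x. N + (2 * C) *\<^sub>R (x - x0))"
  shows "GDERIV (\<lambda>x. m * ((1 - exp (- k * s x)) / k)) x :> (m * exp (- k * s x)) *\<^sub>R S x"
    and "((\<lambda>x. (m * exp (- k * s x)) *\<^sub>R S x) has_derivative
          (\<lambda>v. (m * exp (- k * s x)) *\<^sub>R ((2 * C) *\<^sub>R v - (k * (v \<bullet> S x)) *\<^sub>R S x))) (at x)"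
    and "continuous_on UNIV
          (\<lambda>x. (m * exp (- k * s x)) *\<^sub>R ((2 * C) *\<^sub>R v - (k * (v \<bullet> S x)) *\<^sub>R S x))"
proof -
  have ds: "(s has_derivative (\<lambda>v. v \<bullet> S x)) (at x)" for x
    unfolding s S power2_norm_eq_inner
    by (auto intro!: derivative_eq_intros
        simp: inner_add_right inner_diff_left inner_commute algebra_simps)
  have dexp: "((\<lambda>x. exp (- k * s x)) has_derivative (\<lambda>v. exp (- k * s x) * (- k * (v \<bullet> S x)))) (at x)"
    for x
    by (rule has_derivative_eq_rhs[OF has_derivative_exp[OF has_derivative_mult_right[OF ds]]])
      (auto simp: algebra_simps)
  show "GDERIV (\<lambda>x. m * ((1 - exp (- k * s x)) / k)) x :> (m * exp (- k * s x)) *\<^sub>R S x"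
    unfolding gderiv_def
    by (rule has_derivative_eq_rhs[OF has_derivative_mult_right[OF has_derivative_divide'[OF
              has_derivative_diff[OF has_derivative_const dexp] has_derivative_const]]])
      (use k in \<open>auto simp: power2_eq_square\<close>)
  have dS: "(S has_derivative (\<lambda>v. (2 * C) *\<^sub>R v)) (at x)"
    unfolding S by (auto intro!: derivative_eq_intros simp: scaleR_diff_right)
  show "((\<lambda>x. (m * exp (- k * s x)) *\<^sub>R S x) has_derivative
          (\<lambda>v. (m * exp (- k * s x)) *\<^sub>R ((2 * C) *\<^sub>R v - (k * (v \<bullet> S x)) *\<^sub>R S x))) (at x)"
    by (rule has_derivative_eq_rhs[OF has_derivative_scaleR[OF has_derivative_mult_right[OF dexp] dS]])
      (auto simp: algebra_simps)
  show "continuous_on UNIV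
          (\<lambda>x. (m * exp (- k * s x)) *\<^sub>R ((2 * C) *\<^sub>R v - (k * (v \<bullet> S x)) *\<^sub>R S x))"
    unfolding s S by (intro continuous_intros)
qed

lemma tendsto_extension:
  fixes f F :: "'a::topological_space \<Rightarrow> 'b::topological_space"
  assumes "continuous_on (closure \<Omega>) F" "\<And>x. x \<in> \<Omega> \<Longrightarrow> F x = f x" "x0 \<in> closure \<Omega>"
  shows "(f \<longlongrightarrow> F x0) (at x0 within \<Omega>)"
proof -
  have "(F \<longlongrightarrow> F x0) (at x0 within \<Omega>)"
    using assms(1,3) closure_subset unfolding continuous_on_def by (meson tendsto_within_subset)
  then show ?thesis
    by (rule Lim_transform_eventually) (auto simp: eventually_at_filter assms(2))
qed

lemma upto_boundary_eqI:
  fixes \<Omega> :: "'a::euclidean_space set" and f :: "'a \<Rightarrow> 'b::t2_space"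
  assumes "open \<Omega>" "x0 \<in> frontier \<Omega>" "(f \<longlongrightarrow> l) (at x0 within \<Omega>)"
  shows "upto_boundary \<Omega> f x0 = l"
proof -
  have "x0 \<in> closure \<Omega>" "x0 \<notin> \<Omega>"
    using assms by (auto simp: frontier_def interior_open)
  then have "at x0 within \<Omega> \<noteq> bot"
    by (simp add: closure_def trivial_limit_within)
  with \<open>x0 \<notin> \<Omega>\<close> assms(3) show ?thesis
    unfolding upto_boundary_def by (simp add: tendsto_Lim)
qed

text \<open>
  For \<open>\<sigma> = 1\<close> the test function is raised and becomes a strict supersolution at \<open>x0\<close>; for
  \<open>\<sigma> = -1\<close> it is lowered and becomes a strict subsolution. In both cases the new function
  still touches whatever \<open>\<phi>\<close> touched, on the same side.
\<close>

lemma boundary_barrier: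
  fixes \<Omega> :: "'a::euclidean_space set"
  assumes p: "1 < p" and op: "open \<Omega>" and bd: "C2_boundary \<Omega>" and x0: "x0 \<in> frontier \<Omega>"
    and \<phi>: "C2_closure \<Omega> \<phi>" and \<sigma>: "\<bar>\<sigma>\<bar> = 1"
  obtains \<psi> where "C2_closure \<Omega> \<psi>" "\<psi> x0 = \<phi> x0"
    "\<And>x. x \<in> closure \<Omega> \<Longrightarrow> 0 \<le> \<sigma> * (\<psi> x - \<phi> x)"
    "upto_boundary \<Omega> (grad \<psi>) x0 \<noteq> 0"
    "\<sigma> * upto_boundary \<Omega> (p_laplacian p \<psi>) x0 < 0"
proof -
  have x0c: "x0 \<in> closure \<Omega>" using x0 by (simp add: frontier_def)
  have C2: "C2_on \<Omega> \<phi>" and extends: "extends_to_closure \<Omega> (grad \<phi>)"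
      "\<And>i. i \<in> Basis \<Longrightarrow> extends_to_closure \<Omega> (\<lambda>x. hess \<phi> x i)"
    using \<phi> unfolding C2_closure_def by auto
  obtain G where G: "(grad \<phi> \<longlongrightarrow> G) (at x0 within \<Omega>)"
    using extends(1) tendsto_extension[OF _ _ x0c] unfolding extends_to_closure_def by metis
  have "\<forall>i. \<exists>l. i \<in> Basis \<longrightarrow> ((\<lambda>x. hess \<phi> x i) \<longlongrightarrow> l) (at x0 within \<Omega>)"
    using extends(2) tendsto_extension[OF _ _ x0c] unfolding extends_to_closure_def by metis
  then obtain A where A: "\<And>i. i \<in> Basis \<Longrightarrow> ((\<lambda>x. hess \<phi> x i) \<longlongrightarrow> A i) (at x0 within \<Omega>)"
    by metis
  obtain N C where N: "N \<noteq> 0"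
    and s_nonneg: "\<And>x. x \<in> closure \<Omega> \<Longrightarrow> 0 \<le> (x - x0) \<bullet> N + C * (norm (x - x0))\<^sup>2"
    using C2_boundary_exterior_paraboloid[OF op bd x0] by blast
  have NN: "N \<bullet> N > 0" using N by simp
  have \<sigma>2: "\<sigma> * \<sigma> = 1" using \<sigma> by (metis abs_mult_self_eq mult_1)

  \<comment> \<open>The size of \<open>\<alpha>\<close> keeps \<open>q \<bullet> N\<close> away from zero for either sign \<open>\<sigma>\<close>.\<close>
  define \<alpha> where "\<alpha> = (\<bar>G \<bullet> N\<bar> + 1) / (N \<bullet> N)"
  have \<alpha>: "\<alpha> > 0" using NN unfolding \<alpha>_def by simp
  define q where "q = G + (\<sigma> * \<alpha>) *\<^sub>R N"
  have "\<bar>(\<sigma> * \<alpha>) * (N \<bullet> N)\<bar> = \<bar>G \<bullet> N\<bar> + 1"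
    using NN \<alpha> \<sigma> by (simp add: abs_mult \<alpha>_def)
  then have qN: "q \<bullet> N \<noteq> 0"
    unfolding q_def inner_add_left inner_scaleR_left by linarith
  then have q: "q \<noteq> 0" by auto

  \<comment> \<open>\<open>B\<close> collects the part of the boundary value that does not depend on \<open>k\<close>; the rest is
    \<open>- \<sigma> \<alpha> k R\<close>, and \<open>k\<close> is chosen to make its size exceed \<open>\<bar>B\<bar>\<close>.\<close>
  define R where "R = p_form p q (\<lambda>i. (i \<bullet> N) *\<^sub>R N)"
  have R: "R > 0" unfolding R_def by (rule p_form_rank_one_pos[OF p qN])
  define B where "B = p_form p q (\<lambda>i. A i + (\<sigma> * \<alpha>) *\<^sub>R ((2 * C) *\<^sub>R i))"
  define k where "k = (\<bar>B\<bar> + 1) / (\<alpha> * R)"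
  have k: "k > 0" using R \<alpha> unfolding k_def by simp
  have kR: "k * (\<alpha> * R) = \<bar>B\<bar> + 1" using R \<alpha> unfolding k_def by simp

  define s where "s = (\<lambda>x. (x - x0) \<bullet> N + C * (norm (x - x0))\<^sup>2)"
  define S where "S = (\<lambda>x. N + (2 * C) *\<^sub>R (x - x0))"
  define h where "h = (\<lambda>x. (\<sigma> * \<alpha>) * ((1 - exp (- k * s x)) / k))"
  define gh where "gh = (\<lambda>x. ((\<sigma> * \<alpha>) * exp (- k * s x)) *\<^sub>R S x)"
  define Hh where "Hh = (\<lambda>x v. ((\<sigma> * \<alpha>) * exp (- k * s x)) *\<^sub>R
      ((2 * C) *\<^sub>R v - (k * (v \<bullet> S x)) *\<^sub>R S x))"
  have k0: "k \<noteq> 0" using k by simp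
  note der = exponential_barrier_derivatives[OF k0 s_def S_def, where m = "\<sigma> * \<alpha>"]
  have dh1: "GDERIV h x :> gh x" for x
    unfolding h_def gh_def by (rule der(1))
  have dh2: "(gh has_derivative Hh x) (at x)" for x
    unfolding gh_def Hh_def by (rule der(2))
  note dh = dh1 dh2
  have contH: "continuous_on UNIV (\<lambda>x. Hh x i)" for i
    unfolding Hh_def by (rule der(3))
  define \<psi> where "\<psi> = (\<lambda>x. \<phi> x + h x)"
  have grad\<psi>: "grad \<psi> x = grad \<phi> x + gh x"
    and dgrad\<psi>: "(grad \<psi> has_derivative (\<lambda>v. hess \<phi> x v + Hh x v)) (at x)" if "x \<in> \<Omega>" for x
    unfolding \<psi>_def
    using grad_add_smooth[OF op C2 that dh] has_derivative_grad_add_smooth[OF op C2 that dh]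
    by blast+

  have s0: "s x0 = 0" and S0: "S x0 = N" by (simp_all add: s_def S_def)
  have "(gh \<longlongrightarrow> gh x0) (at x0 within \<Omega>)"
    using dh(2) has_derivative_continuous continuous_at_imp_continuous_at_within
    unfolding continuous_within by blast
  then have "((\<lambda>x. grad \<phi> x + gh x) \<longlongrightarrow> q) (at x0 within \<Omega>)"
    using tendsto_add[OF G] by (simp add: q_def gh_def s0 S0)
  then have limg: "(grad \<psi> \<longlongrightarrow> q) (at x0 within \<Omega>)"
    by (rule Lim_transform_eventually) (auto simp: eventually_at_filter grad\<psi>)
  define Hl where "Hl i = A i + Hh x0 i" for i
  have limH: "((\<lambda>x. hess \<phi> x i + Hh x i) \<longlongrightarrow> Hl i) (at x0 within \<Omega>)" if "i \<in> Basis" for i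
    unfolding Hl_def
    using contH[of i] tendsto_within_subset
    by (intro tendsto_add A[OF that]) (fastforce simp: continuous_on_def)
  have "eventually (\<lambda>x. grad \<psi> x \<noteq> 0) (at x0 within \<Omega>)"
    using tendsto_imp_eventually_ne[OF limg q] .
  then have ev: "eventually (\<lambda>x. p_form p (grad \<psi> x) (\<lambda>i. hess \<phi> x i + Hh x i) = p_laplacian p \<psi> x)
      (at x0 within \<Omega>)"
    unfolding eventually_at_filter
    by eventually_elim (auto simp: p_laplacian_eq_p_form[OF dgrad\<psi>])
  have "((\<lambda>x. p_form p (grad \<psi> x) (\<lambda>i. hess \<phi> x i + Hh x i)) \<longlongrightarrow> p_form p q Hl) (at x0 within \<Omega>)"
    by (rule tendsto_p_form[OF limg limH q])
  then have limp: "(p_laplacian p \<psi> \<longlongrightarrow> p_form p q Hl) (at x0 within \<Omega>)"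
    using ev by (rule Lim_transform_eventually)

  have "Hl = (\<lambda>i. (A i + (\<sigma> * \<alpha>) *\<^sub>R ((2 * C) *\<^sub>R i)) + (- \<sigma> * \<alpha> * k) *\<^sub>R ((i \<bullet> N) *\<^sub>R N))"
    by (rule ext) (simp add: Hl_def Hh_def s0 S0 algebra_simps)
  then have Hl: "p_form p q Hl = B + (- \<sigma> * \<alpha> * k) * R"
    by (simp only: p_form_affine B_def R_def)
  have "\<sigma> * p_form p q Hl = \<sigma> * B - (\<sigma> * \<sigma>) * (k * (\<alpha> * R))"
    unfolding Hl by (simp add: algebra_simps)
  also have "\<dots> \<le> \<bar>B\<bar> - (\<bar>B\<bar> + 1)"
    using \<sigma> abs_ge_self[of "\<sigma> * B"] by (simp add: \<sigma>2 kR abs_mult)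
  finally have neg: "\<sigma> * p_form p q Hl < 0" by simp

  show thesis
  proof (rule that[of \<psi>])
    show "C2_closure \<Omega> \<psi>"
      unfolding \<psi>_def by (rule C2_closure_add_smooth[OF op \<phi> dh contH])
    show "\<psi> x0 = \<phi> x0" by (simp add: \<psi>_def h_def s0)
    show "upto_boundary \<Omega> (grad \<psi>) x0 \<noteq> 0"
      using upto_boundary_eqI[OF op x0 limg] q by simp
    show "\<sigma> * upto_boundary \<Omega> (p_laplacian p \<psi>) x0 < 0"
      using upto_boundary_eqI[OF op x0 limp] neg by simp
    fix x assume "x \<in> closure \<Omega>"
    then have "s x \<ge> 0" using s_nonneg by (simp add: s_def)
    then have "0 \<le> \<alpha> * ((1 - exp (- k * s x)) / k)" using k \<alpha> by simp
    also have "\<dots> = (\<sigma> * \<sigma>) * (\<alpha> * ((1 - exp (- k * s x)) / k))" by (simp add: \<sigma>2)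
    also have "\<dots> = \<sigma> * (\<psi> x - \<phi> x)" by (simp add: \<psi>_def h_def mult.assoc)
    finally show "0 \<le> \<sigma> * (\<psi> x - \<phi> x)" .
  qed
qed


section \<open>Equivalence of the two boundary conditions\<close>

theorem theorem3p3:
  fixes p :: ereal and \<Omega> :: "'a::euclidean_space set" and g u :: "'a \<Rightarrow> real"
  assumes "1 < p"
    and "C2_domain \<Omega>" and "bounded \<Omega>"
    and "continuous_on (frontier \<Omega>) g"
  shows "(viscosity_subsolution p \<Omega> g u \<longleftrightarrow> generalized_viscosity_subsolution p \<Omega> g u) \<and>
         (viscosity_supersolution p \<Omega> g u \<longleftrightarrow> generalized_viscosity_supersolution p \<Omega> g u)"
proof (intro conjI iffI)
  have op: "open \<Omega>" and bd: "C2_boundary \<Omega>"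
    using assms(2) unfolding C2_domain_def by auto
  show "generalized_viscosity_subsolution p \<Omega> g u" if "viscosity_subsolution p \<Omega> g u"
    using that unfolding viscosity_subsolution_def generalized_viscosity_subsolution_def
    by (meson min.coboundedI2)
  show "generalized_viscosity_supersolution p \<Omega> g u" if "viscosity_supersolution p \<Omega> g u"
    using that unfolding viscosity_supersolution_def generalized_viscosity_supersolution_def
    by (meson max.coboundedI2)
  show "viscosity_subsolution p \<Omega> g u" if gen: "generalized_viscosity_subsolution p \<Omega> g u"
  proof -
    have "u x0 - g x0 \<le> 0"
      if x0: "x0 \<in> frontier \<Omega>" and \<phi>: "C2_closure \<Omega> \<phi>" "touches_from_above (closure \<Omega>) \<phi> u x0"
      for x0 \<phi>
    proof -
      obtain \<psi> where \<psi>: "C2_closure \<Omega> \<psi>" "\<psi> x0 = \<phi> x0"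
        "\<And>x. x \<in> closure \<Omega> \<Longrightarrow> 0 \<le> 1 * (\<psi> x - \<phi> x)" "upto_boundary \<Omega> (grad \<psi>) x0 \<noteq> 0"
        "1 * upto_boundary \<Omega> (p_laplacian p \<psi>) x0 < 0"
        using boundary_barrier[OF assms(1) op bd x0 \<phi>(1), of 1] by auto
      have "touches_from_above (closure \<Omega>) \<psi> u x0"
        using \<phi>(2) \<psi>(2,3) unfolding touches_from_above_def by fastforce
      moreover have "x0 \<in> closure \<Omega>" using x0 by (simp add: frontier_def)
      ultimately have "min (- upto_boundary \<Omega> (p_laplacian p \<psi>) x0) (u x0 - g x0) \<le> 0"
        using gen \<psi>(1,4) x0 unfolding generalized_viscosity_subsolution_def by blast
      with \<psi>(5) show ?thesis by (simp add: min_le_iff_disj)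
    qed
    with gen show ?thesis
      unfolding viscosity_subsolution_def generalized_viscosity_subsolution_def by blast
  qed
  show "viscosity_supersolution p \<Omega> g u" if gen: "generalized_viscosity_supersolution p \<Omega> g u"
  proof -
    have "u x0 - g x0 \<ge> 0"
      if x0: "x0 \<in> frontier \<Omega>" and \<phi>: "C2_closure \<Omega> \<phi>" "touches_from_below (closure \<Omega>) \<phi> u x0"
      for x0 \<phi>
    proof -
      obtain \<psi> where \<psi>: "C2_closure \<Omega> \<psi>" "\<psi> x0 = \<phi> x0"
        "\<And>x. x \<in> closure \<Omega> \<Longrightarrow> 0 \<le> -1 * (\<psi> x - \<phi> x)" "upto_boundary \<Omega> (grad \<psi>) x0 \<noteq> 0"
        "-1 * upto_boundary \<Omega> (p_laplacian p \<psi>) x0 < 0"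
        using boundary_barrier[OF assms(1) op bd x0 \<phi>(1), of "-1"] by auto
      have "touches_from_below (closure \<Omega>) \<psi> u x0"
        using \<phi>(2) \<psi>(2,3) unfolding touches_from_below_def by fastforce
      moreover have "x0 \<in> closure \<Omega>" using x0 by (simp add: frontier_def)
      ultimately have "max (- upto_boundary \<Omega> (p_laplacian p \<psi>) x0) (u x0 - g x0) \<ge> 0"
        using gen \<psi>(1,4) x0 unfolding generalized_viscosity_supersolution_def by blast
      with \<psi>(5) show ?thesis by (simp add: le_max_iff_disj)
    qed
    with gen show ?thesis
      unfolding viscosity_supersolution_def generalized_viscosity_supersolution_def by blast
  qed
qed

end
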